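(* Let $v_1,\dots,v_n$ be $n$ points in $\mathbb R^n$ and let $V$ be the $n\times n$ matrix whose $i$-th column is $v_i$ for each $i$. For $i\in[n]$ let $V_{(i)}$ be the matrix obtained from $V$ by replacing line (row) $i$ with the transpose of the vector $(1,\dots,1)\in\mathbb R^n$. Suppose that $|V|_\infty\neq0$. Then $$\mathrm{Lim}_{p\to\infty}H_p(V)=\Big\{x\in\mathbb R^n:\ \mathrm S^-_{i\in[n]}\big(|V_{(i)}|_\infty x_i\big)\le|V|_\infty\le \mathrm S^+_{i\in[n]}\big(|V_{(i)}|_\infty x_i\big)\Big\}.$$
   Context: $[n]=\{1,\dots,n\}$; $t^{1/(2p+1)}$ is the real odd root. For a natural number $p$: $\langle a,x\rangle_p=(\sum_{i}a_i^{2p+1}x_i^{2p+1})^{1/(2p+1)}$, and $|A|_p$ is the $(2p+1)$-th root of the ordinary determinant of $(a_{i,j}^{2p+1})_{i,j}$. A $\varphi_p$-hyperplane is a set $\{x\in\mathbb R^n:\langle a,x\rangle_p=c\}$ with $a\in\mathbb R^n\setminus\{0\}$, $c\in\mathbb R$. When $|V|_p\ne0$ (which holds for all large $p$ if $|V|_\infty\neq0$), $H_p(V)$ denotes the $\varphi_p$-hyperplane passing through $v_1,\dots,v_n$. Determinant in limit: $|A|_\infty=\mathop{\boxplus}_{\sigma\in S_n}\big(\operatorname{sgn}(\sigma)\prod_{i\in[n]}a_{i,\sigma(i)}\big)$, where for a finite family of reals $(x_i)_{i\in I}$, with $\xi(\alpha)=\mathrm{Card}\{i:x_i=\alpha\}-\mathrm{Card}\{i:x_i=-\alpha\}$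 for $\alpha>0$: $\mathop{\boxplus}_{i\in I}x_i=0$ if $\xi(\alpha)=0$ for all $\alpha>0$; otherwise, with $\alpha^\star$ the largest $\alpha>0$ such that $\xi(\alpha)\ne0$, $\mathop{\boxplus}_{i\in I}x_i=\alpha^\star$ if $\xi(\alpha^\star)>0$ and $-\alpha^\star$ if $\xi(\alpha^\star)<0$. The operations $\mathrm S^-$, $\mathrm S^+$ are the iterations of the associative binary operations $\stackrel{-}{\smile}$, $\stackrel{+}{\smile}$ on $\mathbb R$: $u\stackrel{\mp}{\smile}v$ equals $u$ if $|u|>|v|$, equals $v$ if $|u|<|v|$, and if $|u|=|v|$ then $u\stackrel{-}{\smile}v=\min\{u,v\}$ and $u\stackrel{+}{\smile}v=\max\{u,v\}$. So $\mathrm S^{\mp}_{i\in[n]}u_i=u_1\stackrel{\mp}{\smile}\cdots\stackrel{\mp}{\smile}u_n$. $\mathrm{Lim}$ is the Kuratowski–Painlevé limit: $\mathrm{Li}_{p}A_p$ is the set of limits of sequences $x^{(p)}\in A_p$, $\mathrm{Ls}_pA_p$ is the set of limits of sequences $x^{(p_k)}\in A_{p_k}$ along subsequences $(p_k)$, and $\mathrm{Lim}_pA_p=A$ means $\mathrm{Li}_pA_p=\mathrm{Ls}_pA_p=A$. *)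

theory Defs
  imports "HOL-Analysis.Analysis"
begin

definition inner_p :: "nat \<Rightarrow> real^'n \<Rightarrow> real^'n \<Rightarrow> real" where
  "inner_p p a x = root (2*p+1) (\<Sum>i\<in>UNIV. (a$i)^(2*p+1) * (x$i)^(2*p+1))"

definition det_p :: "nat \<Rightarrow> real^'n^'n \<Rightarrow> real" where
  "det_p p A = root (2*p+1) (det (\<chi> i j. (A$i$j)^(2*p+1)))"

definition phi_hyperplane :: "nat \<Rightarrow> (real^'n) set \<Rightarrow> bool" where
  "phi_hyperplane p H \<longleftrightarrow> (\<exists>a c. a \<noteq> 0 \<and> H = {x. inner_p p a x = c})"

(* Meaningful only when det_p p V \<noteq> 0, in which case exactly one phi_p-hyperplane
   contains all columns of V (see ex1_hyperplane_through); otherwise the value is unspecified. *)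
definition hyperplane_through :: "nat \<Rightarrow> real^'n^'n \<Rightarrow> (real^'n) set" where
  "hyperplane_through p V = (THE H. phi_hyperplane p H \<and> (\<forall>i. column i V \<in> H))"

lemma ex1_hyperplane_through:
  fixes V :: "real^'n^'n"
  assumes "det_p p V \<noteq> 0"
  shows "\<exists>!H. phi_hyperplane p H \<and> (\<forall>i. column i V \<in> H)"
proof -
  define q where "q = 2*p+1"
  have q: "odd q" "q > 0" by (auto simp: q_def)
  define M :: "real^'n^'n" where "M = (\<chi> i j. (V$i$j)^q)"
  have "det M \<noteq> 0"
    using assms unfolding det_p_def M_def q_def by auto
  then have "invertible M" by (simp add: invertible_det_nz)
  then obtain N where N: "M ** N = mat 1" "N ** M = mat 1"
    by (auto simp: invertible_def)
  define b where "b = (\<chi> i. 1) v* N"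
  have bM: "b v* M = (\<chi> i. 1)"
    by (simp add: b_def vector_matrix_mul_assoc N)
  have root_eq: "root q y = c \<longleftrightarrow> y = c^q" for y c
    using q by (metis odd_real_root_pow odd_real_root_power_cancel)
  have mem: "inner_p p a x = c \<longleftrightarrow> (\<Sum>i\<in>UNIV. (a$i)^q * (x$i)^q) = c^q" for a x :: "real^'n" and c
    unfolding inner_p_def q_def[symmetric] by (rule root_eq)
  define H0 where "H0 = {x :: real^'n. (\<Sum>i\<in>UNIV. b$i * (x$i)^q) = 1}"
  have cols: "(\<Sum>j\<in>UNIV. b$j * (V$j$i)^q) = 1" for i
  proof -
    have "(b v* M) $ i = (\<Sum>j\<in>UNIV. b$j * (V$j$i)^q)"
      by (simp add: vector_matrix_mult_def M_def mult.commute)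
    then show ?thesis by (simp add: bM)
  qed
  define a0 where "a0 = (\<chi> i. root q (b$i))"
  have a0: "(a0$i)^q = b$i" for i
    using q by (simp add: a0_def odd_real_root_pow)
  have "a0 \<noteq> 0"
  proof
    assume "a0 = 0"
    then have "b$j = 0" for j using a0[of j] q by (simp add: zero_power)
    then show False using cols[of undefined] by simp
  qed
  moreover have "H0 = {x. inner_p p a0 x = 1}"
    by (simp add: H0_def mem a0)
  ultimately have "phi_hyperplane p H0"
    unfolding phi_hyperplane_def by blast
  moreover have "\<forall>i. column i V \<in> H0"
    by (simp add: H0_def column_def cols)
  moreover have "H = H0" if H: "phi_hyperplane p H" "\<forall>i. column i V \<in> H" for H
  proof -
    obtain a c where a: "a \<noteq> 0" and Hac: "H = {x. inner_p p a x = c}"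
      using H(1) unfolding phi_hyperplane_def by blast
    define d where "d = (\<chi> i. (a$i)^q)"
    have "d v* M = c^q *\<^sub>R (\<chi> i. 1)"
      using H(2) by (simp add: vec_eq_iff Hac mem column_def vector_matrix_mult_def M_def d_def mult.commute)
    also have "\<dots> = (c^q *\<^sub>R b) v* M"
      by (simp add: bM scaleR_vector_matrix_assoc)
    finally have "(d v* M) v* N = ((c^q *\<^sub>R b) v* M) v* N" by simp
    then have d: "d = c^q *\<^sub>R b"
      by (simp add: vector_matrix_mul_assoc N)
    then have ab: "(a$i)^q = c^q * b$i" for i
      by (simp add: d_def vec_eq_iff)
    have "c \<noteq> 0"
    proof
      assume "c = 0"
      then have "a$i = 0" for i using ab[of i] q by (simp add: zero_power)
      then show False using a by (simp add: vec_eq_iff)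
    qed
    have "(\<Sum>i\<in>UNIV. (a$i)^q * (x$i)^q) = c^q * (\<Sum>i\<in>UNIV. b$i * (x$i)^q)" for x :: "real^'n"
      by (simp add: ab sum_distrib_left mult.assoc)
    then show ?thesis
      using \<open>c \<noteq> 0\<close> by (simp add: Hac H0_def mem)
  qed
  ultimately show ?thesis by blast
qed

definition sym_count :: "('i \<Rightarrow> real) \<Rightarrow> 'i set \<Rightarrow> real \<Rightarrow> int" where
  "sym_count x I \<alpha> = int (card {i\<in>I. x i = \<alpha>}) - int (card {i\<in>I. x i = - \<alpha>})"

definition boxplus :: "('i \<Rightarrow> real) \<Rightarrow> 'i set \<Rightarrow> real" where
  "boxplus x I =
    (if \<forall>\<alpha>>0. sym_count x I \<alpha> = 0 then 0
     else let m = Max {\<alpha>. \<alpha> > 0 \<and> sym_count x I \<alpha> \<noteq> 0}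
          in if sym_count x I m > 0 then m else - m)"

definition det_inf :: "real^'n^'n \<Rightarrow> real" where
  "det_inf A = boxplus (\<lambda>\<sigma>. of_int (sign \<sigma>) * (\<Prod>i\<in>UNIV. A$i$(\<sigma> i))) {\<sigma>. \<sigma> permutes UNIV}"

definition ones_row :: "'n \<Rightarrow> real^'n^'n \<Rightarrow> real^'n^'n" where
  "ones_row i V = (\<chi> k. if k = i then (\<chi> j. 1) else row k V)"

definition smile_minus :: "real \<Rightarrow> real \<Rightarrow> real" where
  "smile_minus u v = (if \<bar>u\<bar> > \<bar>v\<bar> then u else if \<bar>u\<bar> < \<bar>v\<bar> then v else min u v)"

definition smile_plus :: "real \<Rightarrow> real \<Rightarrow> real" where
  "smile_plus u v = (if \<bar>u\<bar> > \<bar>v\<bar> then u else if \<bar>u\<bar> < \<bar>v\<bar> then v else max u v)"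

(* Both operations are also commutative with neutral element 0, so their iteration does
   not depend on an ordering of the index set; the start value 0 does not affect it. *)
global_interpretation S_minus: comm_monoid_set smile_minus 0
  defines S_minus = S_minus.F
proof unfold_locales
  show "smile_minus (smile_minus a b) c = smile_minus a (smile_minus b c)" for a b c
    unfolding smile_minus_def min_def by (smt (verit))
  show "smile_minus a b = smile_minus b a" for a b
    unfolding smile_minus_def min_def by (smt (verit))
  show "smile_minus a 0 = a" for a
    unfolding smile_minus_def min_def by (smt (verit))
qed

global_interpretation S_plus: comm_monoid_set smile_plus 0
  defines S_plus = S_plus.F
proof unfold_locales
  show "smile_plus (smile_plus a b) c = smile_plus a (smile_plus b c)" for a b c
    unfolding smile_plus_def max_def by (smt (verit))
  show "smile_plus a b = smile_plus b a" for a b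
    unfolding smile_plus_def max_def by (smt (verit))
  show "smile_plus a 0 = a" for a
    unfolding smile_plus_def max_def by (smt (verit))
qed

(* Membership is only required for large p, because the sets to which this is applied
   are only well-defined for large p. *)
definition Li :: "(nat \<Rightarrow> 'a::topological_space set) \<Rightarrow> 'a set" where
  "Li A = {x. \<exists>s. (\<forall>\<^sub>F p in sequentially. s p \<in> A p) \<and> s \<longlonglongrightarrow> x}"

definition Ls :: "(nat \<Rightarrow> 'a::topological_space set) \<Rightarrow> 'a set" where
  "Ls A = {x. \<exists>r s. strict_mono (r :: nat \<Rightarrow> nat) \<and> (\<forall>k. s k \<in> A (r k)) \<and> s \<longlonglongrightarrow> x}"

definition has_Lim :: "(nat \<Rightarrow> 'a::topological_space set) \<Rightarrow> 'a set \<Rightarrow> bool" where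
  "has_Lim A L \<longleftrightarrow> Li A = L \<and> Ls A = L"

lemma Li_nonempty:
  assumes "\<And>p. A p \<noteq> {}"
  shows "Li A = {x. \<exists>s. (\<forall>p. s p \<in> A p) \<and> s \<longlonglongrightarrow> x}"
proof (intro set_eqI iffI)
  fix x assume "x \<in> Li A"
  then obtain s where s: "\<forall>\<^sub>F p in sequentially. s p \<in> A p" "s \<longlonglongrightarrow> x"
    by (auto simp: Li_def)
  define t where "t p = (if s p \<in> A p then s p else (SOME y. y \<in> A p))" for p
  have "t p \<in> A p" for p
    using assms[of p] by (auto simp: t_def some_in_eq)
  moreover have "\<forall>\<^sub>F p in sequentially. s p = t p"
    using s(1) by eventually_elim (simp add: t_def)
  then have "t \<longlonglongrightarrow> x"
    using s(2) tendsto_cong by blast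
  ultimately show "x \<in> {x. \<exists>s. (\<forall>p. s p \<in> A p) \<and> s \<longlonglongrightarrow> x}"
    by blast
qed (fastforce simp: Li_def intro: always_eventually)

end

theory Submission imports Defs begin

text \<open>
  Write \<open>q = 2p + 1\<close>. By Cramer's rule the hyperplane through the columns of \<open>V\<close> is
  \<open>H\<^sub>p(V) = {x. \<langle>a\<^sub>p, x\<rangle>\<^sub>p = c\<^sub>p}\<close>, where \<open>c\<^sub>p = |V|\<^sub>p\<close> and the coordinates of \<open>a\<^sub>p\<close> are the
  \<open>|V\<^sub>(\<^sub>i\<^sub>)|\<^sub>p\<close> (\<open>hyperplane_through_eq\<close>). So the theorem follows from two facts.

  The determinants converge, \<open>|A|\<^sub>p \<longlonglongrightarrow> |A|\<^sub>\<infinity>\<close> (\<open>det_p_tendsto_det_inf\<close>), because in a sum of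
  \<open>q\<close>-th powers opposite terms cancel exactly, and of what remains only the terms of
  largest modulus survive the \<open>q\<close>-th root.

  If \<open>a\<^sub>p \<longlonglongrightarrow> a\<close> and \<open>c\<^sub>p \<longlonglongrightarrow> c \<noteq> 0\<close>, then the sets \<open>{x. \<langle>a\<^sub>p, x\<rangle>\<^sub>p = c\<^sub>p}\<close> converge to
  \<open>{x. S\<^sup>-(a\<^sub>i x\<^sub>i) \<le> c \<le> S\<^sup>+(a\<^sub>i x\<^sub>i)}\<close> (\<open>has_Lim_level_sets\<close>). Both inclusions rest on
  \<open>eventually_root_sum_less\<close> and \<open>eventually_root_sum_greater\<close>: if \<open>u\<^sub>k \<longlonglongrightarrow> u\<close>, then all
  accumulation points of the \<open>q\<close>-th roots of \<open>\<Sum>\<^sub>i u\<^sub>k\<^sub>i\<^sup>q\<close> lie between \<open>S\<^sup>- u\<close> and \<open>S\<^sup>+ u\<close>. This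
  gives the inclusion of the upper limit at once. For the lower limit, a point \<open>x\<close> of the
  limit set is perturbed to points \<open>y\<close> and \<open>z\<close>, as close to \<open>x\<close> as desired, with
  \<open>S\<^sup>+(a\<^sub>i y\<^sub>i) < c < S\<^sup>-(a\<^sub>i z\<^sub>i)\<close>. For large \<open>p\<close> this forces \<open>\<langle>a\<^sub>p, y\<rangle>\<^sub>p < c\<^sub>p < \<langle>a\<^sub>p, z\<rangle>\<^sub>p\<close>, and the
  intermediate value theorem finds a point of the level set on the segment from \<open>y\<close> to \<open>z\<close>.
\<close>

section \<open>The iterated operations \<open>S\<^sup>-\<close> and \<open>S\<^sup>+\<close>\<close>

text \<open>
  These three properties determine \<open>S\<^sup>+\<close>: it is a value of largest modulus, and the positive
  one if both signs occur.
\<close>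

lemma S_plus_props:
  assumes "finite I"
  shows "(\<forall>i\<in>I. \<bar>u i\<bar> \<le> \<bar>S_plus u I\<bar>) \<and> (\<forall>i\<in>I. \<bar>u i\<bar> = \<bar>S_plus u I\<bar> \<longrightarrow> u i \<le> S_plus u I)
    \<and> (S_plus u I = 0 \<or> S_plus u I \<in> u ` I)"
  using assms
proof (induction I rule: finite_induct)
  case empty
  then show ?case by simp
next
  case (insert j I)
  have eq: "S_plus u (insert j I) = smile_plus (u j) (S_plus u I)"
    using insert.hyps by simp
  have abs: "\<bar>smile_plus a b\<bar> = max \<bar>a\<bar> \<bar>b\<bar>" for a b
    by (auto simp: smile_plus_def)
  have le: "\<bar>a\<bar> = \<bar>smile_plus a b\<bar> \<Longrightarrow> a \<le> smile_plus a b"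
    "\<bar>b\<bar> = \<bar>smile_plus a b\<bar> \<Longrightarrow> b \<le> smile_plus a b" for a b
    by (auto simp: smile_plus_def split: if_splits)
  have cases: "smile_plus a b = a \<or> smile_plus a b = b" for a b
    by (auto simp: smile_plus_def max_def)
  let ?S = "S_plus u I" and ?T = "smile_plus (u j) (S_plus u I)"
  have "\<bar>u i\<bar> \<le> \<bar>?T\<bar>" if "i \<in> insert j I" for i
    using that insert.IH unfolding abs by (auto simp: le_max_iff_disj)
  moreover have "u i \<le> ?T" if "i \<in> insert j I" "\<bar>u i\<bar> = \<bar>?T\<bar>" for i
  proof (cases "i = j")
    case True
    then show ?thesis using that(2) le(1) by blast
  next
    case False
    with that(1) have "\<bar>u i\<bar> \<le> \<bar>?S\<bar>" "\<bar>u i\<bar> = \<bar>?S\<bar> \<longrightarrow> u i \<le> ?S"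
      using insert.IH by auto
    moreover have "\<bar>?S\<bar> \<le> \<bar>?T\<bar>" by (simp add: abs)
    ultimately show ?thesis
      using that(2) le(2)[of ?S "u j"] by linarith
  qed
  moreover have "?T = 0 \<or> ?T \<in> u ` insert j I"
    using insert.IH cases[of "u j" ?S] by auto
  ultimately show ?case
    unfolding eq by blast
qed

lemma abs_le_abs_S_plus: "finite I \<Longrightarrow> i \<in> I \<Longrightarrow> \<bar>u i\<bar> \<le> \<bar>S_plus u I\<bar>"
  and le_S_plus_if_abs_eq: "finite I \<Longrightarrow> i \<in> I \<Longrightarrow> \<bar>u i\<bar> = \<bar>S_plus u I\<bar> \<Longrightarrow> u i \<le> S_plus u I"
  and S_plus_eq_0_or_value: "finite I \<Longrightarrow> S_plus u I = 0 \<or> S_plus u I \<in> u ` I"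
  using S_plus_props[of I u] by blast+

text \<open>Through this symmetry every fact on \<open>S\<^sup>-\<close> below is obtained from the one on \<open>S\<^sup>+\<close>.\<close>

lemma S_plus_uminus:
  assumes "finite I"
  shows "S_plus (\<lambda>i. - u i) I = - S_minus u I"
  using assms
proof (induction I rule: finite_induct)
  case (insert j I)
  then show ?case
    by (simp add: smile_plus_def smile_minus_def max_def min_def)
qed simp

lemma abs_S_plus_le:
  assumes "finite I" "0 \<le> B" "\<And>i. i \<in> I \<Longrightarrow> \<bar>u i\<bar> \<le> B"
  shows "\<bar>S_plus u I\<bar> \<le> B"
  using S_plus_eq_0_or_value[OF assms(1), of u] assms(2,3) by auto

lemma abs_S_minus_le:
  assumes "finite I" "0 \<le> B" "\<And>i. i \<in> I \<Longrightarrow> \<bar>u i\<bar> \<le> B"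
  shows "\<bar>S_minus u I\<bar> \<le> B"
  using abs_S_plus_le[of I B "\<lambda>i. - u i"] assms by (simp add: S_plus_uminus)

lemma S_plus_dominant:
  assumes "finite I" "j \<in> I" "\<And>i. i \<in> I \<Longrightarrow> i \<noteq> j \<Longrightarrow> \<bar>u i\<bar> < \<bar>u j\<bar>"
  shows "S_plus u I = u j"
proof -
  have le: "\<bar>u j\<bar> \<le> \<bar>S_plus u I\<bar>"
    using assms(1,2) by (rule abs_le_abs_S_plus)
  consider "S_plus u I = 0" | i where "i \<in> I" "S_plus u I = u i"
    using S_plus_eq_0_or_value[OF assms(1), of u] by auto
  then show ?thesis
  proof cases
    case 1
    then show ?thesis using le by simp
  next
    case 2
    then show ?thesis using le assms(3)[of i] by (cases "i = j") auto
  qed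
qed

lemma S_minus_dominant:
  assumes "finite I" "j \<in> I" "\<And>i. i \<in> I \<Longrightarrow> i \<noteq> j \<Longrightarrow> \<bar>u i\<bar> < \<bar>u j\<bar>"
  shows "S_minus u I = u j"
  using S_plus_dominant[of I j "\<lambda>i. - u i"] assms by (simp add: S_plus_uminus)

section \<open>Roots of sums of large odd powers\<close>

lemma root_uminus_powers:
  fixes q :: nat
  assumes "odd q"
  shows "root q (\<Sum>i\<in>I. (- u i) ^ q) = - root q (\<Sum>i\<in>I. u i ^ q)"
  using assms by (simp add: sum_negf real_root_minus)

lemma root_less_iff_odd:
  assumes "odd q"
  shows "root q x < s \<longleftrightarrow> x < s ^ q"
proof -
  have "0 < q" using assms by (rule odd_pos)
  then have "root q x < root q (s ^ q) \<longleftrightarrow> x < s ^ q"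
    by (rule real_root_less_iff)
  then show ?thesis
    using assms by (simp add: odd_real_root_power_cancel)
qed

lemma eventually_const_mult_power_less:
  fixes t s B :: real
  assumes "0 \<le> t" "t < s" and q: "filterlim q at_top F"
  shows "\<forall>\<^sub>F k in F. B * t ^ q k < s ^ q k"
proof -
  have "(\<lambda>n. (t / s) ^ n) \<longlonglongrightarrow> 0"
    using assms by (intro LIMSEQ_realpow_zero) auto
  then have "((\<lambda>k. B * (t / s) ^ q k) \<longlongrightarrow> B * 0) F"
    by (intro tendsto_mult tendsto_const filterlim_compose[OF _ q])
  then have "\<forall>\<^sub>F k in F. B * (t / s) ^ q k < 1"
    by (rule order_tendstoD) simp
  then show ?thesis
    by eventually_elim (use assms in \<open>simp add: power_divide divide_simps\<close>)
qed

text \<open>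
  If \<open>S\<^sup>+ u\<close> is nonnegative, it bounds all \<open>u\<^sub>i\<close> from above, and so \<open>\<Sum>\<^sub>i u\<^sub>k\<^sub>i\<^sup>q\<close> is at most
  \<open>n t\<^sup>q\<close> with \<open>t < s\<close>. If it is some \<open>-m < 0\<close>, then \<open>-m\<close> is one of the \<open>u\<^sub>i\<close> whereas all \<open>u\<^sub>i\<close> are
  less than \<open>m\<close>; this one negative term outweighs all the positive ones.
\<close>

lemma eventually_root_sum_less:
  fixes u :: "'i \<Rightarrow> real"
  assumes I: "finite I"
    and U: "\<And>i. i \<in> I \<Longrightarrow> ((\<lambda>k. U k i) \<longlongrightarrow> u i) F"
    and q: "filterlim q at_top F" and odd: "\<And>k. odd (q k :: nat)"
    and s: "S_plus u I < s"
  shows "\<forall>\<^sub>F k in F. root (q k) (\<Sum>i\<in>I. U k i ^ q k) < s"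
proof -
  have upper: "\<forall>\<^sub>F k in F. \<forall>i\<in>J. U k i ^ q k \<le> t ^ q k"
    if "J \<subseteq> I" "\<And>i. i \<in> J \<Longrightarrow> u i < t" for t J
  proof -
    have "\<forall>\<^sub>F k in F. U k i < t" if "i \<in> J" for i
      using order_tendstoD(2)[OF U] that \<open>J \<subseteq> I\<close> \<open>\<And>i. i \<in> J \<Longrightarrow> u i < t\<close> by blast
    then have "\<forall>\<^sub>F k in F. \<forall>i\<in>J. U k i < t"
      using finite_subset[OF \<open>J \<subseteq> I\<close> I] by (simp add: eventually_ball_finite_distrib)
    then show ?thesis
      by eventually_elim (use odd power_mono_odd less_imp_le in blast)
  qed
  show ?thesis
  proof (cases "0 \<le> S_plus u I")
    case True
    obtain t where t: "S_plus u I < t" "t < s"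
      using dense[OF s] by blast
    have "u i < t" if "i \<in> I" for i
      using abs_le_abs_S_plus[OF I that, of u] True t by linarith
    then have "\<forall>\<^sub>F k in F. \<forall>i\<in>I. U k i ^ q k \<le> t ^ q k"
      by (intro upper) auto
    moreover have "\<forall>\<^sub>F k in F. real (card I) * t ^ q k < s ^ q k"
      using True t by (intro eventually_const_mult_power_less q) auto
    ultimately show ?thesis
    proof eventually_elim
      case (elim k)
      have "(\<Sum>i\<in>I. U k i ^ q k) \<le> real (card I) * t ^ q k"
        using elim by (intro sum_bounded_above) auto
      then show ?case
        using elim by (simp add: root_less_iff_odd odd)
    qed
  next
    case False
    define m where "m = - S_plus u I"
    have "0 < m" using False by (simp add: m_def)
    obtain j where j: "j \<in> I" "u j = - m"
      using S_plus_eq_0_or_value[OF I, of u] False by (auto simp: m_def)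
    have less_m: "u i < m" if "i \<in> I" for i
      using abs_le_abs_S_plus[OF I that, of u] le_S_plus_if_abs_eq[OF I that, of u] False
      unfolding m_def by linarith
    \<comment> \<open>It suffices to bound the sum by \<open>(- r)\<^sup>q\<close>; truncating at \<open>0\<close> covers all \<open>s \<ge> 0\<close> at once.\<close>
    define r where "r = max 0 (- s)"
    have r: "0 \<le> r" "- r \<le> s" "r < m"
      using s \<open>0 < m\<close> by (auto simp: r_def m_def)
    have "Max (insert r (u ` I)) < m"
      using I r less_m by simp
    then obtain t where t: "Max (insert r (u ` I)) < t" "t < m"
      using dense by blast
    then have t': "r < t" "\<And>i. i \<in> I \<Longrightarrow> u i < t"
      using I by auto
    obtain t2 where t2: "t < t2" "t2 < m"
      using dense[OF t(2)] by blast
    have "\<forall>\<^sub>F k in F. \<forall>i\<in>I - {j}. U k i ^ q k \<le> t ^ q k"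
      using t' by (intro upper) auto
    moreover have "\<forall>\<^sub>F k in F. \<forall>i\<in>{j}. U k i ^ q k \<le> (- t2) ^ q k"
      using j t2 by (intro upper) auto
    moreover have "\<forall>\<^sub>F k in F. (real (card (I - {j})) + 1) * t ^ q k < t2 ^ q k"
      using r t' t2 by (intro eventually_const_mult_power_less q) auto
    ultimately show ?thesis
    proof eventually_elim
      case (elim k)
      have "(\<Sum>i\<in>I. U k i ^ q k) = U k j ^ q k + (\<Sum>i\<in>I - {j}. U k i ^ q k)"
        using I j by (simp add: sum.remove)
      also have "\<dots> \<le> - (t2 ^ q k) + real (card (I - {j})) * t ^ q k"
        using elim odd by (intro add_mono sum_bounded_above) (auto simp: power_minus_odd)
      also have "\<dots> < - (t ^ q k)"
        using elim(3) by (simp add: algebra_simps)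
      also have "\<dots> \<le> (- r) ^ q k"
        using odd r t' by (simp add: power_minus_odd power_mono)
      also have "\<dots> \<le> s ^ q k"
        using r odd by (intro power_mono_odd) auto
      finally show ?case
        by (simp add: root_less_iff_odd odd)
    qed
  qed
qed

lemma eventually_root_sum_greater:
  fixes u :: "'i \<Rightarrow> real"
  assumes I: "finite I"
    and U: "\<And>i. i \<in> I \<Longrightarrow> ((\<lambda>k. U k i) \<longlongrightarrow> u i) F"
    and q: "filterlim q at_top F" and odd: "\<And>k. odd (q k :: nat)"
    and s: "s < S_minus u I"
  shows "\<forall>\<^sub>F k in F. s < root (q k) (\<Sum>i\<in>I. U k i ^ q k)"
proof -
  have "\<forall>\<^sub>F k in F. root (q k) (\<Sum>i\<in>I. (- U k i) ^ q k) < - s"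
    using s by (intro eventually_root_sum_less[OF I tendsto_minus[OF U] q odd])
      (simp_all add: S_plus_uminus[OF I])
  then show ?thesis
    by (simp only: root_uminus_powers[OF odd] neg_less_iff_less)
qed

section \<open>Convergence of the determinants\<close>

lemma filterlim_odd_exponent:
  assumes "filterlim r at_top F"
  shows "filterlim (\<lambda>k. 2 * r k + 1 :: nat) at_top F"
  by (rule filterlim_at_top_mono[OF assms]) auto

lemma root_int_tendsto_sgn:
  fixes z :: int
  assumes "filterlim q at_top F"
  shows "((\<lambda>k. root (q k) (of_int z)) \<longlongrightarrow> of_int (sgn z)) F"
proof -
  have pos: "((\<lambda>k. root (q k) c) \<longlongrightarrow> 1) F" if "0 < c" for c
    using filterlim_compose[OF LIMSEQ_root_const[OF that] assms] .
  consider "z = 0" | "0 < z" | "z < 0" by linarith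
  then show ?thesis
  proof cases
    case 3
    then have "((\<lambda>k. - root (q k) (of_int (- z))) \<longlongrightarrow> - 1) F"
      by (intro tendsto_minus pos) simp
    then show ?thesis
      using 3 by (simp add: real_root_minus)
  qed (use pos in auto)
qed

text \<open>
  Collecting the terms of equal modulus turns the cancellation of opposite terms, which \<open>S\<^sup>\<plusminus>\<close>
  does not perform, into a coefficient \<open>\<xi>(\<alpha>)\<close> for each modulus.
\<close>

lemma sum_odd_powers_by_modulus:
  fixes x :: "'i \<Rightarrow> real"
  assumes "finite I" "odd q"
  shows "(\<Sum>i\<in>I. x i ^ q) = (\<Sum>\<alpha>\<in>(\<lambda>i. \<bar>x i\<bar>) ` I. of_int (sym_count x I \<alpha>) * \<alpha> ^ q)"
proof -
  have "(\<Sum>i\<in>{i\<in>I. \<bar>x i\<bar> = \<alpha>}. x i ^ q) = of_int (sym_count x I \<alpha>) * \<alpha> ^ q"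
    if "0 \<le> \<alpha>" for \<alpha>
  proof (cases "\<alpha> = 0")
    case True
    then show ?thesis using odd_pos[OF assms(2)] by (auto simp: zero_power)
  next
    case False
    with that have "{i\<in>I. \<bar>x i\<bar> = \<alpha>} = {i\<in>I. x i = \<alpha>} \<union> {i\<in>I. x i = - \<alpha>}"
      by auto
    then have "(\<Sum>i\<in>{i\<in>I. \<bar>x i\<bar> = \<alpha>}. x i ^ q)
        = (\<Sum>i\<in>{i\<in>I. x i = \<alpha>}. x i ^ q) + (\<Sum>i\<in>{i\<in>I. x i = - \<alpha>}. x i ^ q)"
      using assms(1) False by (simp only:) (rule sum.union_disjoint, auto)
    also have "\<dots> = of_int (sym_count x I \<alpha>) * \<alpha> ^ q"
      using assms(2) by (simp add: sym_count_def power_minus_odd algebra_simps)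
    finally show ?thesis .
  qed
  then have "(\<Sum>\<alpha>\<in>(\<lambda>i. \<bar>x i\<bar>) ` I. of_int (sym_count x I \<alpha>) * \<alpha> ^ q)
      = (\<Sum>\<alpha>\<in>(\<lambda>i. \<bar>x i\<bar>) ` I. \<Sum>i\<in>{i\<in>I. \<bar>x i\<bar> = \<alpha>}. x i ^ q)"
    by (intro sum.cong) auto
  also have "\<dots> = (\<Sum>i\<in>I. x i ^ q)"
    using assms(1) by (intro sum.group) auto
  finally show ?thesis ..
qed

text \<open>
  After the cancellation at most one signed value is left for each modulus, so that \<open>S\<^sup>-\<close> and
  \<open>S\<^sup>+\<close> agree.
\<close>

lemma boxplus_eq_S:
  fixes x :: "'i \<Rightarrow> real"
  assumes "finite I"
  defines "A \<equiv> (\<lambda>i. \<bar>x i\<bar>) ` I"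
  defines "w \<equiv> \<lambda>\<alpha>. of_int (sgn (sym_count x I \<alpha>)) * \<alpha>"
  shows "S_plus w A = boxplus x I" "S_minus w A = boxplus x I"
proof -
  have A: "finite A" "\<And>\<alpha>. \<alpha> \<in> A \<Longrightarrow> 0 \<le> \<alpha>"
    using assms(1) by (auto simp: A_def)
  have "S_plus w A = boxplus x I \<and> S_minus w A = boxplus x I"
  proof (cases "\<forall>\<alpha>>0. sym_count x I \<alpha> = 0")
    case True
    then have "w \<alpha> = 0" if "\<alpha> \<in> A" for \<alpha>
      using A(2)[OF that] by (cases "\<alpha> = 0") (auto simp: w_def)
    then show ?thesis
      using True abs_S_plus_le[OF A(1), of 0 w] abs_S_minus_le[OF A(1), of 0 w]
      by (simp add: boxplus_def)
  next
    case False
    define B where "B = {\<alpha>. \<alpha> > 0 \<and> sym_count x I \<alpha> \<noteq> 0}"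
    have "\<alpha> \<in> A" if "\<alpha> \<in> B" for \<alpha>
    proof (rule ccontr)
      assume "\<alpha> \<notin> A"
      with that have "{i\<in>I. x i = \<alpha>} = {}" "{i\<in>I. x i = - \<alpha>} = {}"
        by (auto simp: A_def B_def image_iff)
      with that show False
        by (simp add: B_def sym_count_def)
    qed
    then have B: "B \<subseteq> A" "finite B" "B \<noteq> {}"
      using A(1) False by (auto simp: B_def intro: finite_subset)
    define m where "m = Max B"
    have "m \<in> B"
      using B by (simp add: m_def)
    then have m: "m \<in> A" "0 < m" "sym_count x I m \<noteq> 0"
      using B by (auto simp: B_def)
    have box: "boxplus x I = w m"
      using False m unfolding boxplus_def B_def[symmetric] m_def[symmetric]
      by (auto simp: w_def Let_def)
    have dom: "\<bar>w \<alpha>\<bar> < \<bar>w m\<bar>" if "\<alpha> \<in> A" "\<alpha> \<noteq> m" for \<alpha>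
    proof (cases "\<alpha> \<in> B")
      case True
      then have "\<alpha> < m"
        using Max_ge[OF B(2) True] that(2) unfolding m_def by linarith
      then show ?thesis
        using m A(2)[OF that(1)] True by (auto simp: w_def B_def abs_mult sgn_if)
    next
      case False
      then have "w \<alpha> = 0"
        using A(2)[OF that(1)] by (auto simp: B_def w_def)
      then show ?thesis
        using m by (auto simp: w_def sgn_if)
    qed
    show ?thesis
      unfolding box by (intro conjI S_plus_dominant S_minus_dominant A m dom)
  qed
  then show "S_plus w A = boxplus x I" "S_minus w A = boxplus x I"
    by auto
qed

lemma root_sum_tendsto_boxplus:
  fixes x :: "'i \<Rightarrow> real"
  assumes "finite I" and q: "filterlim q at_top F" and odd: "\<And>k. odd (q k :: nat)"
  shows "((\<lambda>k. root (q k) (\<Sum>i\<in>I. x i ^ q k)) \<longlongrightarrow> boxplus x I) F"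
proof -
  define A where "A = (\<lambda>i. \<bar>x i\<bar>) ` I"
  define w where "w \<alpha> = of_int (sgn (sym_count x I \<alpha>)) * \<alpha>" for \<alpha>
  define W where "W k \<alpha> = root (q k) (of_int (sym_count x I \<alpha>)) * \<alpha>" for k \<alpha>
  have sum: "(\<Sum>i\<in>I. x i ^ q k) = (\<Sum>\<alpha>\<in>A. W k \<alpha> ^ q k)" for k
    using sum_odd_powers_by_modulus[OF assms(1) odd, of x k]
    by (simp add: A_def W_def power_mult_distrib odd_real_root_pow odd)
  have A: "finite A"
    using assms(1) by (simp add: A_def)
  have W: "((\<lambda>k. W k \<alpha>) \<longlongrightarrow> w \<alpha>) F" for \<alpha>
    unfolding W_def w_def by (intro tendsto_mult root_int_tendsto_sgn q tendsto_const)
  have S: "S_plus w A = boxplus x I" "S_minus w A = boxplus x I"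
    unfolding A_def w_def by (rule boxplus_eq_S[OF assms(1)])+
  show ?thesis
    unfolding sum
  proof (rule order_tendstoI)
    show "\<forall>\<^sub>F k in F. s < root (q k) (\<Sum>\<alpha>\<in>A. W k \<alpha> ^ q k)" if "s < boxplus x I" for s
      using that by (intro eventually_root_sum_greater[OF A W q odd]) (simp add: S)
    show "\<forall>\<^sub>F k in F. root (q k) (\<Sum>\<alpha>\<in>A. W k \<alpha> ^ q k) < s" if "boxplus x I < s" for s
      using that by (intro eventually_root_sum_less[OF A W q odd]) (simp add: S)
  qed
qed

lemma det_p_tendsto_det_inf:
  fixes A :: "real^'n^'n"
  shows "(\<lambda>p. det_p p A) \<longlonglongrightarrow> det_inf A"
proof -
  let ?x = "\<lambda>\<sigma>. of_int (sign \<sigma>) * (\<Prod>i\<in>UNIV. A$i$(\<sigma> i))"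
  let ?P = "{\<sigma> :: 'n \<Rightarrow> 'n. \<sigma> permutes UNIV}"
  have "real_of_int (sign \<sigma>) ^ (2 * p + 1) = of_int (sign \<sigma>)" for p and \<sigma> :: "'n \<Rightarrow> 'n"
    by (simp add: sign_def)
  then have "det_p p A = root (2 * p + 1) (\<Sum>\<sigma>\<in>?P. ?x \<sigma> ^ (2 * p + 1))" for p
    unfolding det_p_def det_def
    by (simp only: power_mult_distrib prod_power_distrib vec_lambda_beta)
  moreover have "(\<lambda>p. root (2 * p + 1) (\<Sum>\<sigma>\<in>?P. ?x \<sigma> ^ (2 * p + 1))) \<longlonglongrightarrow> boxplus ?x ?P"
    by (intro root_sum_tendsto_boxplus filterlim_odd_exponent filterlim_ident) auto
  ultimately show ?thesis
    by (simp add: det_inf_def)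
qed

section \<open>Kuratowski limits of level sets\<close>

lemma Li_subset_Ls: "Li A \<subseteq> Ls A"
proof
  fix x assume "x \<in> Li A"
  then obtain s where s: "\<forall>\<^sub>F p in sequentially. s p \<in> A p" "s \<longlonglongrightarrow> x"
    by (auto simp: Li_def)
  then obtain N where "\<And>p. N \<le> p \<Longrightarrow> s p \<in> A p"
    by (auto simp: eventually_sequentially)
  moreover have "(\<lambda>k. s (k + N)) \<longlonglongrightarrow> x"
    using s(2) by (rule LIMSEQ_ignore_initial_segment)
  moreover have "strict_mono (\<lambda>k. k + N)"
    by (simp add: strict_mono_def)
  ultimately show "x \<in> Ls A"
    unfolding Ls_def by (intro CollectI exI[of _ "\<lambda>k. k + N"] exI[of _ "\<lambda>k. s (k + N)"]) auto
qed

lemma LiI_eventually_close: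
  fixes x :: "'a::metric_space"
  assumes "\<And>e. 0 < e \<Longrightarrow> \<forall>\<^sub>F p in sequentially. \<exists>y\<in>A p. dist x y < e"
  shows "x \<in> Li A"
proof -
  \<comment> \<open>The infimum defining the distance need not be attained, hence the slack \<open>1 / (p + 1)\<close>.\<close>
  define s where "s p = (SOME y. y \<in> A p \<and> dist x y < infdist x (A p) + 1 / real (Suc p))" for p
  have "\<forall>\<^sub>F p in sequentially. A p \<noteq> {}"
    using assms[OF zero_less_one] by eventually_elim auto
  then have s: "\<forall>\<^sub>F p in sequentially. s p \<in> A p \<and> dist x (s p) < infdist x (A p) + 1 / real (Suc p)"
  proof eventually_elim
    case (elim p)
    have "(INF y\<in>A p. dist x y) < infdist x (A p) + 1 / real (Suc p)"
      using elim by (simp add: infdist_notempty)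
    then have "\<exists>y. y \<in> A p \<and> dist x y < infdist x (A p) + 1 / real (Suc p)"
      using elim by (subst (asm) cINF_less_iff) (auto intro!: bdd_belowI[of _ 0])
    then show ?case
      unfolding s_def by (rule someI_ex)
  qed
  have "(\<lambda>p. infdist x (A p)) \<longlonglongrightarrow> 0"
  proof (rule order_tendstoI)
    show "\<forall>\<^sub>F p in sequentially. e < infdist x (A p)" if "e < 0" for e
      using that infdist_nonneg[of x] by (intro always_eventually) (auto intro: less_le_trans)
    show "\<forall>\<^sub>F p in sequentially. infdist x (A p) < e" if "0 < e" for e
      using assms[OF that] by eventually_elim (auto intro: le_less_trans[OF infdist_le])
  qed
  then have "(\<lambda>p. infdist x (A p) + 1 / real (Suc p)) \<longlonglongrightarrow> 0"
    using tendsto_add[OF _ LIMSEQ_Suc[OF lim_1_over_n]] by fastforce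
  then have "(\<lambda>p. dist (s p) x) \<longlonglongrightarrow> 0"
    by (rule tendsto_sandwich[OF _ _ tendsto_const, rotated 2])
      (use s in \<open>auto elim!: eventually_mono simp: dist_commute\<close>)
  then have "s \<longlonglongrightarrow> x"
    by (rule tendsto_dist_iff[THEN iffD2])
  moreover have "\<forall>\<^sub>F p in sequentially. s p \<in> A p"
    using s by eventually_elim auto
  ultimately show ?thesis
    by (auto simp: Li_def)
qed

lemma inner_p_eq_root_sum: "inner_p p a x = root (2 * p + 1) (\<Sum>i\<in>UNIV. (a$i * x$i) ^ (2 * p + 1))"
  unfolding inner_p_def by (simp only: power_mult_distrib)

text \<open>
  The perturbation depends on the sign of \<open>S\<^sup>+\<close>. A positive value is the positive maximum of the
  moduli and is attained at some \<open>j\<close>; pushing the \<open>j\<close>-th coordinate outwards makes it dominate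
  strictly. For a negative value \<open>-m\<close> the maximum of the moduli is \<open>m\<close>, and shrinking \<open>x\<close> brings all of
  them below \<open>m \<le> -c\<close>.
  For \<open>S\<^sup>+ = 0\<close> nothing can be gained by shrinking, but then \<open>c\<close>, being nonzero, already lies
  strictly below.
\<close>

lemma exists_close_S_minus_greater:
  fixes a x :: "real^'n::finite"
  assumes c: "c \<le> S_plus (\<lambda>i. a$i * x$i) UNIV" "c \<noteq> 0" and "0 < e"
  shows "\<exists>y. dist x y < e \<and> c < S_minus (\<lambda>i. a$i * y$i) UNIV"
proof (cases "0 < S_plus (\<lambda>i. a$i * x$i) UNIV")
  case True
  define m where "m = S_plus (\<lambda>i. a$i * x$i) UNIV"
  have bound: "\<bar>a$i * x$i\<bar> \<le> m" for i
    using abs_le_abs_S_plus[of UNIV i "\<lambda>i. a$i * x$i"] True by (simp add: m_def)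
  obtain j where j: "a$j * x$j = m"
    using S_plus_eq_0_or_value[of UNIV "\<lambda>i. a$i * x$i"] True by (auto simp: m_def)
  then have "a$j \<noteq> 0"
    using True by (auto simp: m_def)
  define y where "y = x + (e / 2 * sgn (a$j)) *\<^sub>R axis j 1"
  have yj: "a$j * y$j = m + e / 2 * \<bar>a$j\<bar>"
    using j by (simp add: y_def axis_def algebra_simps abs_sgn)
  have "0 < e / 2 * \<bar>a$j\<bar>"
    using \<open>a$j \<noteq> 0\<close> \<open>0 < e\<close> by simp
  then have gt: "m < a$j * y$j"
    using yj by linarith
  have "S_minus (\<lambda>i. a$i * y$i) UNIV = a$j * y$j"
  proof (rule S_minus_dominant)
    fix i assume "i \<noteq> j"
    then have "y$i = x$i"
      by (simp add: y_def axis_def)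
    then show "\<bar>a$i * y$i\<bar> < \<bar>a$j * y$j\<bar>"
      using bound[of i] gt by simp
  qed auto
  moreover have "dist x y < e"
    using \<open>0 < e\<close> \<open>a$j \<noteq> 0\<close> by (simp add: y_def dist_norm abs_mult abs_sgn_eq)
  ultimately show ?thesis
    using gt c(1) by (intro exI[of _ y]) (simp add: m_def)
next
  case False
  define m where "m = - S_plus (\<lambda>i. a$i * x$i) UNIV"
  have "0 \<le> m"
    using False by (simp add: m_def)
  have bound: "\<bar>a$i * x$i\<bar> \<le> m" for i
    using abs_le_abs_S_plus[of UNIV i "\<lambda>i. a$i * x$i"] False by (simp add: m_def)
  define d where "d = min 1 (e / (2 * (norm x + 1)))"
  have d: "0 < d" "d \<le> 1"
    using \<open>0 < e\<close> by (auto simp: d_def add_nonneg_pos)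
  define y where "y = (1 - d) *\<^sub>R x"
  have "\<bar>a$i * y$i\<bar> \<le> (1 - d) * m" for i
  proof -
    have "\<bar>a$i * y$i\<bar> = (1 - d) * \<bar>a$i * x$i\<bar>"
      using d by (simp add: y_def abs_mult)
    then show ?thesis
      using d bound[of i] by (simp add: mult_left_mono)
  qed
  then have "\<bar>S_minus (\<lambda>i. a$i * y$i) UNIV\<bar> \<le> (1 - d) * m"
    using d \<open>0 \<le> m\<close> by (intro abs_S_minus_le) auto
  then have "- m + d * m \<le> S_minus (\<lambda>i. a$i * y$i) UNIV"
    by (simp add: algebra_simps abs_le_iff)
  moreover have "c < - m + d * m"
  proof (cases "m = 0")
    case True
    then show ?thesis using c by (simp add: m_def)
  next
    case False
    then have "0 < d * m" using d \<open>0 \<le> m\<close> by simp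
    then show ?thesis using c by (simp add: m_def)
  qed
  moreover have "dist x y < e"
  proof -
    have "dist x y = d * norm x"
      using d by (simp add: y_def dist_norm algebra_simps)
    also have "\<dots> \<le> e / (2 * (norm x + 1)) * (norm x + 1)"
      using d by (intro mult_mono) (auto simp: d_def)
    also have "\<dots> = e / 2"
      using norm_ge_zero[of x] by (simp add: field_simps add_nonneg_eq_0_iff)
    finally show ?thesis using \<open>0 < e\<close> by simp
  qed
  ultimately show ?thesis
    by (intro exI[of _ y]) simp
qed

lemma exists_close_S_plus_less:
  fixes a x :: "real^'n::finite"
  assumes c: "S_minus (\<lambda>i. a$i * x$i) UNIV \<le> c" "c \<noteq> 0" and "0 < e"
  shows "\<exists>y. dist x y < e \<and> S_plus (\<lambda>i. a$i * y$i) UNIV < c"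
proof -
  have "- c \<le> S_plus (\<lambda>i. a$i * (- x)$i) UNIV"
    using c(1) by (simp add: S_plus_uminus)
  then obtain y where y: "dist (- x) y < e" "- c < S_minus (\<lambda>i. a$i * y$i) UNIV"
    using exists_close_S_minus_greater[of "- c" a "- x" e] c(2) \<open>0 < e\<close> by auto
  have "dist x (- y) = dist (- x) y"
    using dist_minus[of x "- y"] by simp
  moreover have "S_plus (\<lambda>i. a$i * (- y)$i) UNIV = - S_minus (\<lambda>i. a$i * y$i) UNIV"
    by (simp add: S_plus_uminus)
  ultimately show ?thesis
    using y by (intro exI[of _ "- y"]) simp
qed

lemma inner_p_attains_between:
  fixes a y z :: "real^'n::finite"
  assumes "inner_p p a y \<le> c" "c \<le> inner_p p a z" and "y \<in> S" "z \<in> S" "convex S"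
  shows "\<exists>x\<in>S. inner_p p a x = c"
proof -
  let ?f = "\<lambda>t. inner_p p a ((1 - t) *\<^sub>R y + t *\<^sub>R z)"
  have "continuous_on {0..1} ?f"
    unfolding inner_p_def by (intro continuous_intros)
  then obtain t where "0 \<le> t" "t \<le> 1" "?f t = c"
    using IVT'[of ?f 0 c 1] assms(1,2) by auto
  then show ?thesis
    using convexD_alt[OF assms(5,3,4), of t] by blast
qed

text \<open>
  The condition \<open>c\<^sub>0 \<noteq> 0\<close> cannot be dropped: for \<open>a\<^sub>p = 0\<close> and \<open>c\<^sub>p = 1 / (p + 1)\<close> the level sets are
  empty, whereas the asserted limit would be the whole space.
\<close>

theorem has_Lim_level_sets:
  fixes a :: "nat \<Rightarrow> real^'n::finite"
  assumes H: "\<forall>\<^sub>F p in sequentially. H p = {x. inner_p p (a p) x = c p}"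
    and a: "a \<longlonglongrightarrow> a0" and c: "c \<longlonglongrightarrow> c0" and "c0 \<noteq> 0"
  shows "has_Lim H {x. S_minus (\<lambda>i. a0$i * x$i) UNIV \<le> c0 \<and> c0 \<le> S_plus (\<lambda>i. a0$i * x$i) UNIV}"
    (is "has_Lim H ?L")
proof -
  have upper: "Ls H \<subseteq> ?L"
  proof
    fix x assume "x \<in> Ls H"
    then obtain r s where r: "strict_mono (r :: nat \<Rightarrow> nat)"
      and s: "\<And>k. s k \<in> H (r k)" "s \<longlonglongrightarrow> x"
      by (auto simp: Ls_def)
    have r': "filterlim r at_top sequentially"
      using r by (rule filterlim_subseq)
    have U: "(\<lambda>k. a (r k) $ i * s k $ i) \<longlonglongrightarrow> a0$i * x$i" for i
      by (intro tendsto_mult tendsto_vec_nth s(2) filterlim_compose[OF a r'])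
    have q: "filterlim (\<lambda>k. 2 * r k + 1) at_top sequentially" "\<And>k. odd (2 * r k + 1)"
      using filterlim_odd_exponent[OF r'] by auto
    have "\<forall>\<^sub>F k in sequentially. H (r k) = {x. inner_p (r k) (a (r k)) x = c (r k)}"
      using H r' by (rule eventually_compose_filterlim)
    then have eq: "\<forall>\<^sub>F k in sequentially.
        c (r k) = root (2 * r k + 1) (\<Sum>i\<in>UNIV. (a (r k) $ i * s k $ i) ^ (2 * r k + 1))"
      unfolding inner_p_eq_root_sum[symmetric]
      proof eventually_elim
        case (elim k)
        show ?case using s(1)[of k] unfolding elim by simp
      qed
    have cr: "(\<lambda>k. c (r k)) \<longlonglongrightarrow> c0"
      by (rule filterlim_compose[OF c r'])
    have "c0 \<le> S_plus (\<lambda>i. a0$i * x$i) UNIV"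
    proof (rule dense_ge)
      fix t assume "S_plus (\<lambda>i. a0$i * x$i) UNIV < t"
      from eventually_root_sum_less[OF finite U q this] eq
      have "\<forall>\<^sub>F k in sequentially. c (r k) \<le> t"
        by eventually_elim simp
      then show "c0 \<le> t"
        by (rule tendsto_upperbound[OF cr]) simp
    qed
    moreover have "S_minus (\<lambda>i. a0$i * x$i) UNIV \<le> c0"
    proof (rule dense_le)
      fix t assume "t < S_minus (\<lambda>i. a0$i * x$i) UNIV"
      from eventually_root_sum_greater[OF finite U q this] eq
      have "\<forall>\<^sub>F k in sequentially. t \<le> c (r k)"
        by eventually_elim simp
      then show "t \<le> c0"
        by (rule tendsto_lowerbound[OF cr]) simp
    qed
    ultimately show "x \<in> ?L" by simp
  qed
  have lower: "?L \<subseteq> Li H"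
  proof
    fix x assume x: "x \<in> ?L"
    show "x \<in> Li H"
    proof (rule LiI_eventually_close)
      fix e :: real assume "0 < e"
      obtain y where y: "dist x y < e" "S_plus (\<lambda>i. a0$i * y$i) UNIV < c0"
        using exists_close_S_plus_less[of a0 x c0 e] x \<open>c0 \<noteq> 0\<close> \<open>0 < e\<close> by auto
      obtain z where z: "dist x z < e" "c0 < S_minus (\<lambda>i. a0$i * z$i) UNIV"
        using exists_close_S_minus_greater[of c0 a0 x e] x \<open>c0 \<noteq> 0\<close> \<open>0 < e\<close> by auto
      have U: "(\<lambda>p. a p $ i * w $ i) \<longlonglongrightarrow> a0$i * w$i" for i and w :: "real^'n"
        by (intro tendsto_mult tendsto_vec_nth tendsto_const a)
      have q: "filterlim (\<lambda>p. 2 * p + 1 :: nat) at_top sequentially" "\<And>p. odd (2 * p + 1 :: nat)"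
        using filterlim_odd_exponent[OF filterlim_ident] by auto
      obtain t1 where t1: "S_plus (\<lambda>i. a0$i * y$i) UNIV < t1" "t1 < c0"
        using dense[OF y(2)] by blast
      obtain t2 where t2: "c0 < t2" "t2 < S_minus (\<lambda>i. a0$i * z$i) UNIV"
        using dense[OF z(2)] by blast
      from eventually_root_sum_less[OF finite U q t1(1)]
        eventually_root_sum_greater[OF finite U q t2(2)]
        order_tendstoD(1)[OF c t1(2)] order_tendstoD(2)[OF c t2(1)] H
      show "\<forall>\<^sub>F p in sequentially. \<exists>y\<in>H p. dist x y < e"
      proof eventually_elim
        case (elim p)
        have "inner_p p (a p) y \<le> c p" "c p \<le> inner_p p (a p) z"
          using elim by (auto simp only: inner_p_eq_root_sum)
        then have "\<exists>w\<in>ball x e. inner_p p (a p) w = c p"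
          using y(1) z(1) by (intro inner_p_attains_between[of p "a p" y "c p" z]) auto
        then show ?case
          using elim by auto
      qed
    qed
  qed
  show ?thesis
    using upper lower Li_subset_Ls[of H] unfolding has_Lim_def by blast
qed

section \<open>The hyperplane through the columns\<close>

text \<open>
  Cramer's rule for the system \<open>M\<^sup>T b = (1, \<dots>, 1)\<close>, whose solution is the normal vector of the
  hyperplane through the columns of \<open>M\<close>.
\<close>

lemma ones_row_cramer:
  fixes M :: "real^'n^'n::finite"
  assumes "det M \<noteq> 0"
  shows "(\<Sum>i\<in>UNIV. det (ones_row i M) * M$i$j) = det M"
proof -
  define b :: "real^'n" where "b = (\<chi> k. det (ones_row k M) / det M)"
  have "(\<chi> i j. if j = k then (1 :: real^'n)$i else transpose M $ i $ j) = transpose (ones_row k M)" for k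
    by (simp add: vec_eq_iff transpose_def ones_row_def row_def)
  then have "b = (\<chi> k. det (\<chi> i j. if j = k then (1 :: real^'n)$i else transpose M $ i $ j) / det (transpose M))"
    by (simp add: b_def det_transpose)
  then have "transpose M *v b = 1"
    using cramer[of "transpose M" b 1] assms by (simp add: det_transpose)
  then have "(\<Sum>i\<in>UNIV. M$i$j * (det (ones_row i M) / det M)) = 1"
    by (simp add: vec_eq_iff matrix_vector_mult_def transpose_def b_def)
  then show ?thesis
    using assms by (simp add: sum_divide_distrib[symmetric] mult.commute)
qed

lemma hyperplane_through_eq:
  fixes V :: "real^'n^'n::finite"
  assumes "det_p p V \<noteq> 0"
  shows "hyperplane_through p V = {x. inner_p p (\<chi> i. det_p p (ones_row i V)) x = det_p p V}"
proof -
  define q where "q = 2 * p + 1"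
  have q: "odd q" "0 < q" by (auto simp: q_def)
  define M :: "real^'n^'n" where "M = (\<chi> i j. (V$i$j) ^ q)"
  have detV: "det_p p V = root q (det M)"
    by (simp add: det_p_def M_def q_def)
  have "(\<chi> k j. (ones_row i V $ k $ j) ^ q) = ones_row i M" for i
    by (simp add: vec_eq_iff ones_row_def row_def M_def)
  then have detVi: "det_p p (ones_row i V) ^ q = det (ones_row i M)" for i
    using q unfolding det_p_def q_def[symmetric] by (simp add: odd_real_root_pow)
  have "det M \<noteq> 0"
    using assms by (auto simp: detV)
  then have cols: "(\<Sum>i\<in>UNIV. det_p p (ones_row i V) ^ q * (V$i$j) ^ q) = det M" for j
    using ones_row_cramer[of M j] by (simp add: detVi M_def)
  define a :: "real^'n" where "a = (\<chi> i. det_p p (ones_row i V))"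
  let ?H = "{x. inner_p p a x = det_p p V}"
  have "a \<noteq> 0"
  proof
    assume "a = 0"
    then have "det_p p (ones_row i V) = 0" for i
      by (simp add: a_def vec_eq_iff)
    then show False
      using cols[of undefined] \<open>det M \<noteq> 0\<close> q by (simp add: zero_power)
  qed
  then have "phi_hyperplane p ?H"
    unfolding phi_hyperplane_def by blast
  moreover have "\<forall>j. column j V \<in> ?H"
    unfolding inner_p_def q_def[symmetric] by (simp add: column_def a_def detV cols)
  ultimately have "hyperplane_through p V = ?H"
    unfolding hyperplane_through_def
    by (intro the1_equality ex1_hyperplane_through assms) blast
  then show ?thesis
    by (simp add: a_def)
qed

theorem proposition4p3p1:
  fixes v :: "'n::finite \<Rightarrow> real^'n" and V :: "real^'n^'n"
  assumes "\<forall>i. column i V = v i"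
    and "det_inf V \<noteq> 0"
  shows "has_Lim (\<lambda>p. hyperplane_through p V)
           {x. S_minus (\<lambda>i. det_inf (ones_row i V) * x$i) UNIV \<le> det_inf V \<and>
               det_inf V \<le> S_plus (\<lambda>i. det_inf (ones_row i V) * x$i) UNIV}"
proof -
  have "\<forall>\<^sub>F p in sequentially. det_p p V \<noteq> 0"
    using det_p_tendsto_det_inf assms(2) by (rule tendsto_imp_eventually_ne)
  then have "\<forall>\<^sub>F p in sequentially. hyperplane_through p V
      = {x. inner_p p (\<chi> i. det_p p (ones_row i V)) x = det_p p V}"
    by eventually_elim (rule hyperplane_through_eq)
  moreover have "(\<lambda>p. \<chi> i. det_p p (ones_row i V)) \<longlonglongrightarrow> (\<chi> i. det_inf (ones_row i V))"
    by (intro tendsto_vec_lambda det_p_tendsto_det_inf)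
  ultimately show ?thesis
    using has_Lim_level_sets[OF _ _ det_p_tendsto_det_inf assms(2)] by fastforce
qed

end
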